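(* Let $(C,e,\lambda,\oplus)$ be the free Catalan structure, and let $h,\mathrm{rev}\colon C\to C$ be the (size-preserving) involutions defined in the context. The group $\langle h,\mathrm{rev}\rangle$ of permutations of $C$ generated by $h$ and $\mathrm{rev}$ is the free product $\mathbb{Z}_2*\mathbb{Z}_2$ (of the order-two groups generated by $h$ and by $\mathrm{rev}$). In particular, $M=h\circ\mathrm{rev}$ has infinite order, and the orders $\operatorname{ord}(M|_{C_n})$, $n\ge 0$, of the permutations that $M$ induces on the finite sets $C_n$ are unbounded.
   Context: A Catalan structure is a quadruple $(C,e,\lambda,\oplus)$ where $C=\bigsqcup_{n\ge 0}C_n$ with $C_0=\{e\}$ ($|t|=n$ for $t\in C_n$), $\lambda\colon C_n\to C_{n+1}$, $\oplus\colon C_m\times C_n\to C_{m+n}$, $\oplus$ is associative with two-sided identity $e$, and every $t\in C$ can be written uniquely in exactly one of three forms: $t=e$; $t=\lambda(s)$ with $s\in C$ (indecomposable); $t=u\oplus v$ with $u$ indecomposable and $v\in C\setminus C_0$ (decomposable). Hence every nonempty $t$ is uniquely $\lambda(u)\oplus v$ ($v=e$ allowed). The free Catalan structure is realized by the formal expressions $e$, $\lambda(t)$, $\lambda(u)\oplus v$ with $v\ne e$; it is isomorphic to rooted plane trees written as lists of children, with $e=[\,]$, $\lambda(T)=[T]$, $\oplus$ = concatenation of child lists, size = number of edges. Put $\gamma(t)=t\oplus\lambda(e)$ and define $\ominus$ by $e\ominus v=v$, $\lambda(u)\ominus v=\lambda(u\ominus v)$, $(t\oplus u)\ominus v=t\oplus(u\ominus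 v)$ for $t,u\ne e$ (well defined; one may take $t$ indecomposable). The maps: $h(e)=e$, $h(\lambda(u)\oplus v)=h(v)\ominus\gamma(h(u))$; $\mathrm{rev}(e)=e$, $\mathrm{rev}(\lambda(u)\oplus v)=\mathrm{rev}(v)\oplus\lambda(\mathrm{rev}(u))$. *)

theory Defs
  imports "HOL-Algebra.Algebra"
begin

section \<open>Catalan structures\<close>

locale catalan_structure =
  fixes C :: "nat \<Rightarrow> 'a set"
    and e :: 'a
    and lam :: "'a \<Rightarrow> 'a"
    and oplus :: "'a \<Rightarrow> 'a \<Rightarrow> 'a"
  assumes grades_disjoint: "m \<noteq> n \<Longrightarrow> C m \<inter> C n = {}"
    and grade_0: "C 0 = {e}"
    and lam_grade: "t \<in> C n \<Longrightarrow> lam t \<in> C (Suc n)"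
    and oplus_grade: "t \<in> C m \<Longrightarrow> u \<in> C n \<Longrightarrow> oplus t u \<in> C (m + n)"
    and oplus_assoc:
      "\<lbrakk>t \<in> (\<Union>n. C n); u \<in> (\<Union>n. C n); v \<in> (\<Union>n. C n)\<rbrakk>
        \<Longrightarrow> oplus (oplus t u) v = oplus t (oplus u v)"
    and oplus_left_neutral: "t \<in> (\<Union>n. C n) \<Longrightarrow> oplus e t = t"
    and oplus_right_neutral: "t \<in> (\<Union>n. C n) \<Longrightarrow> oplus t e = t"
    and exhaust_forms:
      "t \<in> (\<Union>n. C n) \<Longrightarrow>
        t = e \<or> t \<in> lam ` (\<Union>n. C n) \<or>
        (\<exists>u \<in> lam ` (\<Union>n. C n). \<exists>v \<in> (\<Union>n. C n) - C 0. t = oplus u v)"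
    and lam_inj: "inj_on lam (\<Union>n. C n)"
    and decomposable_unique:
      "\<lbrakk>u \<in> lam ` (\<Union>n. C n); v \<in> (\<Union>n. C n) - C 0;
        u' \<in> lam ` (\<Union>n. C n); v' \<in> (\<Union>n. C n) - C 0; oplus u v = oplus u' v'\<rbrakk>
        \<Longrightarrow> u = u' \<and> v = v'"
    and lam_neq_empty: "t \<in> (\<Union>n. C n) \<Longrightarrow> lam t \<noteq> e"
    and decomposable_neq_empty:
      "\<lbrakk>u \<in> lam ` (\<Union>n. C n); v \<in> (\<Union>n. C n) - C 0\<rbrakk> \<Longrightarrow> oplus u v \<noteq> e"
    and lam_neq_decomposable:
      "\<lbrakk>t \<in> (\<Union>n. C n); u \<in> lam ` (\<Union>n. C n); v \<in> (\<Union>n. C n) - C 0\<rbrakk>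
        \<Longrightarrow> lam t \<noteq> oplus u v"


section \<open>The free Catalan structure\<close>

text \<open>
  \<open>Join u v\<close> is the formal expression \<open>\<lambda>(u) \<oplus> v\<close>, where \<open>v\<close> may be the empty
  expression, in which case it is \<open>\<lambda>(u)\<close>.
\<close>

datatype catalan = Emp | Join catalan catalan

primrec catalan_size :: "catalan \<Rightarrow> nat" where
  "catalan_size Emp = 0"
| "catalan_size (Join u v) = Suc (catalan_size u + catalan_size v)"

definition catalan_level :: "nat \<Rightarrow> catalan set" where
  "catalan_level n = {t. catalan_size t = n}"

definition lam :: "catalan \<Rightarrow> catalan" where
  "lam u = Join u Emp"

primrec oplus :: "catalan \<Rightarrow> catalan \<Rightarrow> catalan" (infixr "\<oplus>c" 65) where
  "Emp \<oplus>c w = w"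
| "Join u v \<oplus>c w = Join u (v \<oplus>c w)"

lemma Join_eq: "Join u v = lam u \<oplus>c v"
  by (simp add: lam_def)

lemma oplus_Emp [simp]: "t \<oplus>c Emp = t"
  by (induction t) auto

lemma oplus_assoc: "(t \<oplus>c u) \<oplus>c v = t \<oplus>c (u \<oplus>c v)"
  by (induction t) auto

lemma oplus_eq_Emp [simp]: "t \<oplus>c u = Emp \<longleftrightarrow> t = Emp \<and> u = Emp"
  by (cases t) auto

lemma catalan_size_oplus [simp]: "catalan_size (t \<oplus>c u) = catalan_size t + catalan_size u"
  by (induction t) auto

lemma catalan_size_lam [simp]: "catalan_size (lam t) = Suc (catalan_size t)"
  by (simp add: lam_def)

lemma catalan_size_eq_0 [simp]: "catalan_size t = 0 \<longleftrightarrow> t = Emp"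
  by (cases t) auto

lemma UN_catalan_level [simp]: "(\<Union>n. catalan_level n) = UNIV"
  by (auto simp: catalan_level_def)

lemma catalan_level_0: "catalan_level 0 = {Emp}"
  by (auto simp: catalan_level_def)

lemma finite_catalan_level: "finite (catalan_level n)"
proof (induction n rule: less_induct)
  case (less n)
  have "catalan_level n \<subseteq>
      insert Emp (\<Union>i<n. \<Union>j<n. (\<lambda>(u, v). Join u v) ` (catalan_level i \<times> catalan_level j))"
  proof
    fix t assume "t \<in> catalan_level n"
    then show "t \<in> insert Emp
        (\<Union>i<n. \<Union>j<n. (\<lambda>(u, v). Join u v) ` (catalan_level i \<times> catalan_level j))"
      by (cases t) (force simp: catalan_level_def)+
  qed
  moreover have "finite (insert Emp
      (\<Union>i<n. \<Union>j<n. (\<lambda>(u, v). Join u v) ` (catalan_level i \<times> catalan_level j)))"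
    using less.IH by auto
  ultimately show ?case
    by (rule finite_subset)
qed

lemma catalan_structure_catalan: "catalan_structure catalan_level Emp lam (\<oplus>c)"
proof
  fix t :: catalan
  show "t = Emp \<or> t \<in> lam ` (\<Union>n. catalan_level n) \<or>
    (\<exists>u \<in> lam ` (\<Union>n. catalan_level n).
      \<exists>v \<in> (\<Union>n. catalan_level n) - catalan_level 0. t = u \<oplus>c v)"
  proof (cases t)
    case (Join u v)
    then show ?thesis
      by (cases "v = Emp") (auto simp: lam_def catalan_level_0)
  qed simp
qed (auto simp: catalan_level_def lam_def oplus_assoc inj_on_def)

lemma catalan_free:
  assumes "catalan_structure C e l p"
  shows "\<exists>!\<phi>. (\<forall>n. \<phi> ` catalan_level n \<subseteq> C n) \<and> \<phi> Emp = e \<and>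
    (\<forall>t. \<phi> (lam t) = l (\<phi> t)) \<and> (\<forall>t u. \<phi> (t \<oplus>c u) = p (\<phi> t) (\<phi> u))"
proof -
  interpret S: catalan_structure C e l p by fact
  define \<phi> where "\<phi> = rec_catalan e (\<lambda>_ _ x y. p (l x) y)"
  have \<phi>_simps: "\<phi> Emp = e" "\<phi> (Join u v) = p (l (\<phi> u)) (\<phi> v)" for u v
    by (simp_all add: \<phi>_def)
  have gr: "\<phi> t \<in> C (catalan_size t)" for t
    by (induction t) (use S.oplus_grade S.lam_grade S.grade_0 in \<open>force simp: \<phi>_simps\<close>)+
  then have U: "\<phi> t \<in> (\<Union>n. C n)" "l (\<phi> t) \<in> (\<Union>n. C n)" for t
    using S.lam_grade by blast+
  have \<phi>_lam: "\<phi> (lam t) = l (\<phi> t)" for t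
    using S.oplus_right_neutral[OF U(2)] by (simp add: lam_def \<phi>_simps)
  have \<phi>_oplus: "\<phi> (t \<oplus>c u) = p (\<phi> t) (\<phi> u)" for t u
    by (induction t) (simp_all add: \<phi>_simps S.oplus_left_neutral[OF U(1)]
        S.oplus_assoc[OF U(2) U(1) U(1)])
  show ?thesis
  proof (rule ex1I[of _ \<phi>])
    show "(\<forall>n. \<phi> ` catalan_level n \<subseteq> C n) \<and> \<phi> Emp = e \<and>
      (\<forall>t. \<phi> (lam t) = l (\<phi> t)) \<and> (\<forall>t u. \<phi> (t \<oplus>c u) = p (\<phi> t) (\<phi> u))"
      using gr \<phi>_simps \<phi>_lam \<phi>_oplus by (auto simp: catalan_level_def)
  next
    fix \<psi> assume \<psi>: "(\<forall>n. \<psi> ` catalan_level n \<subseteq> C n) \<and> \<psi> Emp = e \<and>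
      (\<forall>t. \<psi> (lam t) = l (\<psi> t)) \<and> (\<forall>t u. \<psi> (t \<oplus>c u) = p (\<psi> t) (\<psi> u))"
    have "\<psi> t = \<phi> t" for t
    proof (induction t)
      case (Join u v)
      have "\<psi> (Join u v) = p (l (\<psi> u)) (\<psi> v)"
        using \<psi> by (metis Join_eq)
      then show ?case
        using Join by (simp add: \<phi>_simps)
    qed (use \<psi> in \<open>simp add: \<phi>_simps\<close>)
    then show "\<psi> = \<phi>" ..
  qed
qed


section \<open>The maps \<open>h\<close> and \<open>rev\<close>\<close>

definition gam :: "catalan \<Rightarrow> catalan" where
  "gam t = t \<oplus>c lam Emp"

fun ominus :: "catalan \<Rightarrow> catalan \<Rightarrow> catalan" (infixr "\<ominus>c" 65) where
  "Emp \<ominus>c w = w"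
| "Join u Emp \<ominus>c w = Join (u \<ominus>c w) Emp"
| "Join u (Join x y) \<ominus>c w = Join u (Join x y \<ominus>c w)"

lemma ominus_lam: "lam u \<ominus>c w = lam (u \<ominus>c w)"
  by (simp add: lam_def)

lemma ominus_oplus: "t \<noteq> Emp \<Longrightarrow> u \<noteq> Emp \<Longrightarrow> (t \<oplus>c u) \<ominus>c w = t \<oplus>c (u \<ominus>c w)"
proof (induction t)
  case (Join x y)
  show ?case
  proof (cases "y = Emp")
    case True
    with Join.prems show ?thesis
      by (cases u) auto
  next
    case False
    with Join show ?thesis
      by (cases "y \<oplus>c u") auto
  qed
qed simp

primrec cat_h :: "catalan \<Rightarrow> catalan" where
  "cat_h Emp = Emp"
| "cat_h (Join u v) = cat_h v \<ominus>c gam (cat_h u)"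

primrec cat_rev :: "catalan \<Rightarrow> catalan" where
  "cat_rev Emp = Emp"
| "cat_rev (Join u v) = cat_rev v \<oplus>c lam (cat_rev u)"

lemma cat_h_lam_oplus: "cat_h (lam u \<oplus>c v) = cat_h v \<ominus>c gam (cat_h u)"
  by (simp add: lam_def)

lemma cat_rev_lam_oplus: "cat_rev (lam u \<oplus>c v) = cat_rev v \<oplus>c lam (cat_rev u)"
  by (simp add: lam_def)

lemma catalan_size_ominus [simp]: "catalan_size (t \<ominus>c u) = catalan_size t + catalan_size u"
  by (induction t u rule: ominus.induct) auto

lemma catalan_size_cat_h [simp]: "catalan_size (cat_h t) = catalan_size t"
  by (induction t) (auto simp: gam_def)

lemma catalan_size_cat_rev [simp]: "catalan_size (cat_rev t) = catalan_size t"
  by (induction t) auto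

lemma cat_rev_oplus: "cat_rev (t \<oplus>c u) = cat_rev u \<oplus>c cat_rev t"
  by (induction t) (auto simp: oplus_assoc)

lemma cat_rev_cat_rev [simp]: "cat_rev (cat_rev t) = t"
  by (induction t) (auto simp: cat_rev_oplus lam_def)

lemma ominus_Emp [simp]: "t \<ominus>c Emp = t"
proof (induction t)
  case (Join u v)
  then show ?case by (cases v) auto
qed simp

lemma ominus_eq_Emp [simp]: "t \<ominus>c u = Emp \<longleftrightarrow> t = Emp \<and> u = Emp"
  by (induction t u rule: ominus.induct) auto

lemma ominus_assoc: "(t \<ominus>c u) \<ominus>c w = t \<ominus>c (u \<ominus>c w)"
proof (induction t u rule: ominus.induct)
  case (3 u x y v)
  have "Join x y \<ominus>c v \<noteq> Emp" by simp
  then show ?case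
    using 3 by (cases "Join x y \<ominus>c v") auto
qed auto

lemma cat_h_oplus: "cat_h (t \<oplus>c u) = cat_h u \<ominus>c cat_h t"
  by (induction t) (auto simp: ominus_assoc)

lemma cat_h_eq_Emp [simp]: "cat_h t = Emp \<longleftrightarrow> t = Emp"
  by (metis catalan_size_cat_h catalan_size_eq_0)

lemma cat_h_ominus: "cat_h (t \<ominus>c u) = cat_h u \<oplus>c cat_h t"
proof (induction t u rule: ominus.induct)
  case (2 v u)
  then show ?case by (simp add: gam_def oplus_assoc)
next
  case (3 v x y u)
  have "(cat_h u \<oplus>c cat_h (Join x y)) \<ominus>c gam (cat_h v)
      = cat_h u \<oplus>c (cat_h (Join x y) \<ominus>c gam (cat_h v))"
  proof (cases "u = Emp")
    case False
    then show ?thesis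
      by (intro ominus_oplus) (simp_all only: cat_h_eq_Emp catalan.distinct not_False_eq_True)
  qed simp
  with 3 show ?case by simp
qed simp

lemma cat_h_cat_h [simp]: "cat_h (cat_h t) = t"
proof (induction t)
  case (Join u v)
  have "cat_h (gam (cat_h u)) = lam u"
    using Join(1) by (simp add: gam_def cat_h_oplus lam_def)
  with Join(2) show ?case
    by (simp add: cat_h_ominus lam_def)
qed simp

lemma bij_cat_h: "bij cat_h"
  by (rule involuntory_imp_bij) simp

lemma bij_cat_rev: "bij cat_rev"
  by (rule involuntory_imp_bij) simp

abbreviation generated_perms :: "(catalan \<Rightarrow> catalan) set \<Rightarrow> (catalan \<Rightarrow> catalan) monoid" where
  "generated_perms \<equiv> subgroup_generated (BijGroup UNIV)"

lemma cat_h_in_BijGroup: "cat_h \<in> carrier (BijGroup UNIV)"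
  and cat_rev_in_BijGroup: "cat_rev \<in> carrier (BijGroup UNIV)"
  by (simp_all add: BijGroup_def Bij_def bij_cat_h bij_cat_rev)

lemma restrict_cat_h_cat_rev_in_BijGroup:
  "restrict (cat_h \<circ> cat_rev) (catalan_level n) \<in> carrier (BijGroup (catalan_level n))"
proof -
  have "bij_betw (cat_h \<circ> cat_rev) (catalan_level n) (catalan_level n)"
    by (rule bij_betw_byWitness[where f' = "cat_rev \<circ> cat_h"]) (auto simp: catalan_level_def)
  then show ?thesis
    by (simp add: BijGroup_def Bij_def bij_betw_restrict_eq)
qed


section \<open>Free products of groups\<close>

definition reduced_words ::
    "('a, 'c) monoid_scheme \<Rightarrow> ('b, 'd) monoid_scheme \<Rightarrow> ('a + 'b) list set" where
  "reduced_words G H =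
    {w. set w \<subseteq> Sum_Type.Plus (carrier G - {\<one>\<^bsub>G\<^esub>}) (carrier H - {\<one>\<^bsub>H\<^esub>}) \<and>
        successively (\<lambda>x y. isl x \<noteq> isl y) w}"

text \<open>Multiplication of a reduced word from the left by an element of one of the factors.\<close>

primrec letter_mult ::
    "('a, 'c) monoid_scheme \<Rightarrow> ('b, 'd) monoid_scheme \<Rightarrow> 'a + 'b \<Rightarrow> ('a + 'b) list \<Rightarrow> ('a + 'b) list"
  where
  "letter_mult G H (Inl a) w =
    (if a = \<one>\<^bsub>G\<^esub> then w else
      (case w of
        Inl b # w' \<Rightarrow> if a \<otimes>\<^bsub>G\<^esub> b = \<one>\<^bsub>G\<^esub> then w' else Inl (a \<otimes>\<^bsub>G\<^esub> b) # w'
      | _ \<Rightarrow> Inl a # w))"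
| "letter_mult G H (Inr a) w =
    (if a = \<one>\<^bsub>H\<^esub> then w else
      (case w of
        Inr b # w' \<Rightarrow> if a \<otimes>\<^bsub>H\<^esub> b = \<one>\<^bsub>H\<^esub> then w' else Inr (a \<otimes>\<^bsub>H\<^esub> b) # w'
      | _ \<Rightarrow> Inr a # w))"

definition free_product ::
    "('a, 'c) monoid_scheme \<Rightarrow> ('b, 'd) monoid_scheme \<Rightarrow> ('a + 'b) list monoid" where
  "free_product G H =
    \<lparr>carrier = reduced_words G H, monoid.mult = foldr (letter_mult G H), one = []\<rparr>"

text \<open>The map out of the free product that is induced by maps \<open>f\<close>, \<open>g\<close> on the factors.\<close>

definition free_product_lift ::
    "('k, 'm) monoid_scheme \<Rightarrow> ('a \<Rightarrow> 'k) \<Rightarrow> ('b \<Rightarrow> 'k) \<Rightarrow> ('a + 'b) list \<Rightarrow> 'k" where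
  "free_product_lift K f g w = foldr (\<lambda>x y. case_sum f g x \<otimes>\<^bsub>K\<^esub> y) w \<one>\<^bsub>K\<^esub>"

context
  fixes G :: "('a, 'c) monoid_scheme" and H :: "('b, 'd) monoid_scheme"
  assumes G: "group G" and H: "group H"
begin

interpretation G: group G by (fact G)
interpretation H: group H by (fact H)

lemma Nil_reduced: "[] \<in> reduced_words G H"
  by (simp add: reduced_words_def)

lemma reduced_ConsD:
  assumes "x # w \<in> reduced_words G H"
  shows "w \<in> reduced_words G H" "x \<in> Sum_Type.Plus (carrier G) (carrier H)" "letter_mult G H x w = x # w"
proof -
  show "w \<in> reduced_words G H" "x \<in> Sum_Type.Plus (carrier G) (carrier H)"
    using assms by (auto simp: reduced_words_def successively_Cons)
  show "letter_mult G H x w = x # w"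
    using assms by (cases x; cases w)
      (auto simp: reduced_words_def successively_Cons split: sum.splits)
qed

lemma letter_mult_reduced:
  assumes "x \<in> Sum_Type.Plus (carrier G) (carrier H)" "w \<in> reduced_words G H"
  shows "letter_mult G H x w \<in> reduced_words G H"
  using assms
  by (cases x; cases w; cases "tl w")
    (auto simp: reduced_words_def successively_Cons split: sum.splits)

lemma letter_mult_Inl_Inl:
  assumes "a \<in> carrier G" "b \<in> carrier G" "w \<in> reduced_words G H"
  shows "letter_mult G H (Inl a) (letter_mult G H (Inl b) w) = letter_mult G H (Inl (a \<otimes>\<^bsub>G\<^esub> b)) w"
proof (cases "\<exists>c w'. w = Inl c # w'")
  case True
  then obtain c w' where w: "w = Inl c # w'" by blast
  with assms have c: "c \<in> carrier G" "c \<noteq> \<one>\<^bsub>G\<^esub>"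
      and w': "\<And>d w''. w' \<noteq> Inl d # w''"
    by (auto simp: reduced_words_def successively_Cons)
  have app: "(case w' of Inl d # w'' \<Rightarrow> F d w'' | _ \<Rightarrow> z) = z"
    for F and z :: "('a + 'b) list"
    using w' by (auto split: list.splits sum.splits)
  have bc: "b \<otimes>\<^bsub>G\<^esub> c = \<one>\<^bsub>G\<^esub> \<Longrightarrow> a \<otimes>\<^bsub>G\<^esub> b \<otimes>\<^bsub>G\<^esub> c = a"
    using assms c by (simp add: G.m_assoc)
  have ab: "a \<otimes>\<^bsub>G\<^esub> b = \<one>\<^bsub>G\<^esub> \<Longrightarrow> a \<otimes>\<^bsub>G\<^esub> (b \<otimes>\<^bsub>G\<^esub> c) = c"
    using assms c by (simp flip: G.m_assoc)
  have "a = \<one>\<^bsub>G\<^esub> \<Longrightarrow> a \<otimes>\<^bsub>G\<^esub> b = b" "b = \<one>\<^bsub>G\<^esub> \<Longrightarrow> a \<otimes>\<^bsub>G\<^esub> b = a"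
    using assms by auto
  then show ?thesis
    using assms c bc ab by (auto simp: w app G.m_assoc)
next
  case False
  then have app: "(case w of Inl d # w'' \<Rightarrow> F d w'' | _ \<Rightarrow> z) = z"
    for F and z :: "('a + 'b) list"
    by (auto split: list.splits sum.splits)
  show ?thesis
    using assms by (auto simp: app)
qed

lemma letter_mult_Inr_Inr:
  assumes "a \<in> carrier H" "b \<in> carrier H" "w \<in> reduced_words G H"
  shows "letter_mult G H (Inr a) (letter_mult G H (Inr b) w) = letter_mult G H (Inr (a \<otimes>\<^bsub>H\<^esub> b)) w"
proof (cases "\<exists>c w'. w = Inr c # w'")
  case True
  then obtain c w' where w: "w = Inr c # w'" by blast
  with assms have c: "c \<in> carrier H" "c \<noteq> \<one>\<^bsub>H\<^esub>"
      and w': "\<And>d w''. w' \<noteq> Inr d # w''"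
    by (auto simp: reduced_words_def successively_Cons)
  have app: "(case w' of Inr d # w'' \<Rightarrow> F d w'' | _ \<Rightarrow> z) = z"
    for F and z :: "('a + 'b) list"
    using w' by (auto split: list.splits sum.splits)
  have bc: "b \<otimes>\<^bsub>H\<^esub> c = \<one>\<^bsub>H\<^esub> \<Longrightarrow> a \<otimes>\<^bsub>H\<^esub> b \<otimes>\<^bsub>H\<^esub> c = a"
    using assms c by (simp add: H.m_assoc)
  have ab: "a \<otimes>\<^bsub>H\<^esub> b = \<one>\<^bsub>H\<^esub> \<Longrightarrow> a \<otimes>\<^bsub>H\<^esub> (b \<otimes>\<^bsub>H\<^esub> c) = c"
    using assms c by (simp flip: H.m_assoc)
  have "a = \<one>\<^bsub>H\<^esub> \<Longrightarrow> a \<otimes>\<^bsub>H\<^esub> b = b" "b = \<one>\<^bsub>H\<^esub> \<Longrightarrow> a \<otimes>\<^bsub>H\<^esub> b = a"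
    using assms by auto
  then show ?thesis
    using assms c bc ab by (auto simp: w app H.m_assoc)
next
  case False
  then have app: "(case w of Inr d # w'' \<Rightarrow> F d w'' | _ \<Rightarrow> z) = z"
    for F and z :: "('a + 'b) list"
    by (auto split: list.splits sum.splits)
  show ?thesis
    using assms by (auto simp: app)
qed

lemma foldr_letter_mult_reduced:
  assumes "set v \<subseteq> Sum_Type.Plus (carrier G) (carrier H)" "w \<in> reduced_words G H"
  shows "foldr (letter_mult G H) v w \<in> reduced_words G H"
  using assms by (induction v) (auto simp: letter_mult_reduced simp del: letter_mult.simps)

lemma reduced_letters: "w \<in> reduced_words G H \<Longrightarrow> set w \<subseteq> Sum_Type.Plus (carrier G) (carrier H)"
  by (auto simp: reduced_words_def)

lemma foldr_letter_mult_letter_mult: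
  assumes "x \<in> Sum_Type.Plus (carrier G) (carrier H)" "v \<in> reduced_words G H" "w \<in> reduced_words G H"
  shows "foldr (letter_mult G H) (letter_mult G H x v) w =
    letter_mult G H x (foldr (letter_mult G H) v w)"
proof (cases v)
  case Nil
  then show ?thesis by (cases x) auto
next
  case (Cons y v')
  have y: "y \<in> Sum_Type.Plus (carrier G) (carrier H)" and v': "v' \<in> reduced_words G H"
    using reduced_ConsD[of y v'] assms Cons by auto
  define z where "z = foldr (letter_mult G H) v' w"
  have z: "z \<in> reduced_words G H"
    unfolding z_def using foldr_letter_mult_reduced reduced_letters v' assms(3) by blast
  show ?thesis
  proof (cases x)
    case (Inl a)
    with assms have a: "a \<in> carrier G" by auto
    show ?thesis
    proof (cases y)
      case (Inl b)
      with y have b: "b \<in> carrier G" by auto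
      have "foldr (letter_mult G H) (letter_mult G H x v) w = letter_mult G H (Inl (a \<otimes>\<^bsub>G\<^esub> b)) z"
        using a b by (auto simp: z_def Cons Inl \<open>x = Inl a\<close> split: list.splits sum.splits)
      then show ?thesis
        using letter_mult_Inl_Inl[OF a b z]
        by (simp add: Cons Inl \<open>x = Inl a\<close> z_def del: letter_mult.simps)
    qed (auto simp: Cons Inl)
  next
    case (Inr a)
    with assms have a: "a \<in> carrier H" by auto
    show ?thesis
    proof (cases y)
      case (Inr b)
      with y have b: "b \<in> carrier H" by auto
      have "foldr (letter_mult G H) (letter_mult G H x v) w = letter_mult G H (Inr (a \<otimes>\<^bsub>H\<^esub> b)) z"
        using a b by (auto simp: z_def Cons Inr \<open>x = Inr a\<close> split: list.splits sum.splits)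
      then show ?thesis
        using letter_mult_Inr_Inr[OF a b z]
        by (simp add: Cons Inr \<open>x = Inr a\<close> z_def del: letter_mult.simps)
    qed (auto simp: Cons Inr)
  qed
qed

lemma group_free_product: "group (free_product G H)"
proof (rule groupI)
  fix u v w
  assume "u \<in> carrier (free_product G H)" "v \<in> carrier (free_product G H)"
    "w \<in> carrier (free_product G H)"
  then have *: "set u \<subseteq> Sum_Type.Plus (carrier G) (carrier H)" "v \<in> reduced_words G H" "w \<in> reduced_words G H"
    using reduced_letters by (auto simp: free_product_def)
  then have "foldr (letter_mult G H) (foldr (letter_mult G H) u v) w =
      foldr (letter_mult G H) u (foldr (letter_mult G H) v w)"
    by (induction u) (auto simp: foldr_letter_mult_letter_mult foldr_letter_mult_reduced
        simp del: letter_mult.simps)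
  then show "u \<otimes>\<^bsub>free_product G H\<^esub> v \<otimes>\<^bsub>free_product G H\<^esub> w =
      u \<otimes>\<^bsub>free_product G H\<^esub> (v \<otimes>\<^bsub>free_product G H\<^esub> w)"
    by (simp add: free_product_def)
next
  fix w assume "w \<in> carrier (free_product G H)"
  then have "w \<in> reduced_words G H" by (simp add: free_product_def)
  then have "\<exists>v. set v \<subseteq> Sum_Type.Plus (carrier G) (carrier H) \<and> foldr (letter_mult G H) v w = []"
  proof (induction w)
    case Nil
    show ?case by (rule exI[of _ "[]"]) simp
  next
    case (Cons x w)
    note xw = reduced_ConsD[OF Cons.prems]
    obtain v where v: "set v \<subseteq> Sum_Type.Plus (carrier G) (carrier H)" "foldr (letter_mult G H) v w = []"
      using Cons.IH xw(1) by blast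
    have one: "letter_mult G H (Inl \<one>\<^bsub>G\<^esub>) w = w" "letter_mult G H (Inr \<one>\<^bsub>H\<^esub>) w = w"
      by simp_all
    have "\<exists>x' \<in> Sum_Type.Plus (carrier G) (carrier H). letter_mult G H x' (x # w) = w"
    proof (cases x)
      case (Inl a)
      with xw(2) have a: "a \<in> carrier G" by auto
      have "letter_mult G H (Inl (inv\<^bsub>G\<^esub> a)) (x # w) = w"
        using letter_mult_Inl_Inl[of "inv\<^bsub>G\<^esub> a" a w] a xw(1,3) Inl one by (simp del: letter_mult.simps)
      moreover have "Inl (inv\<^bsub>G\<^esub> a) \<in> Sum_Type.Plus (carrier G) (carrier H)"
        using a by auto
      ultimately show ?thesis by blast
    next
      case (Inr a)
      with xw(2) have a: "a \<in> carrier H" by auto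
      have "letter_mult G H (Inr (inv\<^bsub>H\<^esub> a)) (x # w) = w"
        using letter_mult_Inr_Inr[of "inv\<^bsub>H\<^esub> a" a w] a xw(1,3) Inr one by (simp del: letter_mult.simps)
      moreover have "Inr (inv\<^bsub>H\<^esub> a) \<in> Sum_Type.Plus (carrier G) (carrier H)"
        using a by auto
      ultimately show ?thesis by blast
    qed
    then obtain x' where "x' \<in> Sum_Type.Plus (carrier G) (carrier H)" "letter_mult G H x' (x # w) = w" ..
    with v show ?case
      by (intro exI[of _ "v @ [x']"]) (simp del: letter_mult.simps)
  qed
  then obtain v where v: "set v \<subseteq> Sum_Type.Plus (carrier G) (carrier H)" "foldr (letter_mult G H) v w = []"
    by blast
  define v' where "v' = foldr (letter_mult G H) v []"
  have v': "v' \<in> reduced_words G H"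
    unfolding v'_def using v(1) Nil_reduced foldr_letter_mult_reduced by blast
  have "foldr (letter_mult G H) v' w = foldr (letter_mult G H) v w"
    unfolding v'_def using v(1) \<open>w \<in> reduced_words G H\<close>
    by (induction v) (auto simp: foldr_letter_mult_letter_mult foldr_letter_mult_reduced Nil_reduced
        simp del: letter_mult.simps)
  with v v' show "\<exists>v\<in>carrier (free_product G H). v \<otimes>\<^bsub>free_product G H\<^esub> w = \<one>\<^bsub>free_product G H\<^esub>"
    by (intro bexI[of _ v']) (auto simp: free_product_def)
qed (use foldr_letter_mult_reduced reduced_letters in \<open>auto simp: free_product_def Nil_reduced\<close>)

context
  fixes K :: "('k, 'm) monoid_scheme" and f :: "'a \<Rightarrow> 'k" and g :: "'b \<Rightarrow> 'k"
  assumes K: "group K" and f: "f \<in> hom G K" and g: "g \<in> hom H K"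
begin

interpretation K: group K by (fact K)
interpretation f: group_hom G K f by unfold_locales (fact f)
interpretation g: group_hom H K g by unfold_locales (fact g)

lemma free_product_lift_closed:
  "set w \<subseteq> Sum_Type.Plus (carrier G) (carrier H) \<Longrightarrow> free_product_lift K f g w \<in> carrier K"
  by (induction w) (auto simp: free_product_lift_def)

lemma free_product_lift_letter_mult:
  assumes "x \<in> Sum_Type.Plus (carrier G) (carrier H)" "w \<in> reduced_words G H"
  shows "free_product_lift K f g (letter_mult G H x w) =
    case_sum f g x \<otimes>\<^bsub>K\<^esub> free_product_lift K f g w"
proof (cases w)
  case Nil
  then show ?thesis
    using assms by (cases x) (auto simp: free_product_lift_def)
next
  case (Cons y w')
  have y: "y \<in> Sum_Type.Plus (carrier G) (carrier H)" and w': "set w' \<subseteq> Sum_Type.Plus (carrier G) (carrier H)"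
    using assms(2) Cons reduced_ConsD reduced_letters by blast+
  have cl: "foldr (\<lambda>x y. case_sum f g x \<otimes>\<^bsub>K\<^esub> y) w' \<one>\<^bsub>K\<^esub> \<in> carrier K"
    using free_product_lift_closed[OF w'] by (simp add: free_product_lift_def)
  have 1: "f a \<otimes>\<^bsub>K\<^esub> (f b \<otimes>\<^bsub>K\<^esub> z) = z"
    if "a \<otimes>\<^bsub>G\<^esub> b = \<one>\<^bsub>G\<^esub>" "a \<in> carrier G" "b \<in> carrier G" "z \<in> carrier K" for a b z
    using that f.hom_mult[of a b] by (simp flip: K.m_assoc f.hom_mult)
  have 2: "g a \<otimes>\<^bsub>K\<^esub> (g b \<otimes>\<^bsub>K\<^esub> z) = z"
    if "a \<otimes>\<^bsub>H\<^esub> b = \<one>\<^bsub>H\<^esub>" "a \<in> carrier H" "b \<in> carrier H" "z \<in> carrier K" for a b z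
    using that g.hom_mult[of a b] by (simp flip: K.m_assoc g.hom_mult)
  show ?thesis
    using assms(1) y cl 1 2 Cons
    by (cases x; cases y) (auto simp: free_product_lift_def K.m_assoc)
qed

lemma free_product_lift_hom: "free_product_lift K f g \<in> hom (free_product G H) K"
proof (rule homI)
  fix v w assume "v \<in> carrier (free_product G H)" "w \<in> carrier (free_product G H)"
  then have "set v \<subseteq> Sum_Type.Plus (carrier G) (carrier H)" and w: "w \<in> reduced_words G H"
    using reduced_letters by (auto simp: free_product_def)
  then have "free_product_lift K f g (foldr (letter_mult G H) v w) =
      free_product_lift K f g v \<otimes>\<^bsub>K\<^esub> free_product_lift K f g w"
  proof (induction v)
    case Nil
    then show ?case
      using free_product_lift_closed[OF reduced_letters[OF w]] by (simp add: free_product_lift_def)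
  next
    case (Cons x v)
    have x: "x \<in> Sum_Type.Plus (carrier G) (carrier H)" and v: "set v \<subseteq> Sum_Type.Plus (carrier G) (carrier H)"
      using Cons.prems by auto
    then have "case_sum f g x \<in> carrier K" by auto
    moreover have "free_product_lift K f g (x # v) = case_sum f g x \<otimes>\<^bsub>K\<^esub> free_product_lift K f g v"
      by (simp add: free_product_lift_def)
    ultimately show ?case
      using Cons x v w free_product_lift_letter_mult[OF x foldr_letter_mult_reduced[OF v w]]
        free_product_lift_closed[OF v] free_product_lift_closed[OF reduced_letters[OF w]]
      by (simp add: K.m_assoc del: letter_mult.simps)
  qed
  then show "free_product_lift K f g (v \<otimes>\<^bsub>free_product G H\<^esub> w) =
      free_product_lift K f g v \<otimes>\<^bsub>K\<^esub> free_product_lift K f g w"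
    by (simp add: free_product_def)
qed (use free_product_lift_closed reduced_letters in \<open>simp add: free_product_def\<close>)

text \<open>
  The embedding of a factor sends \<open>a\<close> to \<open>letter_mult G H (Inl a) []\<close>, respectively to
  \<open>letter_mult G H (Inr a) []\<close>; the next two facts are the universal property.
\<close>

lemma free_product_lift_factors:
  "a \<in> carrier G \<Longrightarrow> free_product_lift K f g (letter_mult G H (Inl a) []) = f a"
  "b \<in> carrier H \<Longrightarrow> free_product_lift K f g (letter_mult G H (Inr b) []) = g b"
  by (auto simp: free_product_lift_def)

lemma free_product_lift_unique:
  assumes \<phi>: "\<phi> \<in> hom (free_product G H) K"
    and l: "\<And>a. a \<in> carrier G \<Longrightarrow> \<phi> (letter_mult G H (Inl a) []) = f a"
    and r: "\<And>b. b \<in> carrier H \<Longrightarrow> \<phi> (letter_mult G H (Inr b) []) = g b"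
    and w: "w \<in> carrier (free_product G H)"
  shows "\<phi> w = free_product_lift K f g w"
proof -
  have "w \<in> reduced_words G H" using w by (simp add: free_product_def)
  then show ?thesis
  proof (induction w)
    case Nil
    have "\<phi> [] = \<one>\<^bsub>K\<^esub>"
      using hom_one[OF \<phi> group_free_product K] by (simp add: free_product_def)
    then show ?case by (simp add: free_product_lift_def)
  next
    case (Cons x w)
    note xw = reduced_ConsD[OF Cons.prems]
    have sg: "[x] \<in> reduced_words G H"
      using Cons.prems by (auto simp: reduced_words_def)
    have "x # w = [x] \<otimes>\<^bsub>free_product G H\<^esub> w"
      using xw(3) by (simp add: free_product_def)
    then have "\<phi> (x # w) = \<phi> [x] \<otimes>\<^bsub>K\<^esub> \<phi> w"
      using hom_mult[OF \<phi>, of "[x]" w] sg xw(1) by (simp add: free_product_def)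
    moreover have "\<phi> [x] = case_sum f g x"
    proof (cases x)
      case (Inl a)
      with sg have "a \<in> carrier G" "a \<noteq> \<one>\<^bsub>G\<^esub>" by (auto simp: reduced_words_def)
      with l[of a] Inl show ?thesis by simp
    next
      case (Inr b)
      with sg have "b \<in> carrier H" "b \<noteq> \<one>\<^bsub>H\<^esub>" by (auto simp: reduced_words_def)
      with r[of b] Inr show ?thesis by simp
    qed
    ultimately show ?case
      using Cons.IH xw(1) by (simp add: free_product_lift_def)
  qed
qed

end

end

end

theory Submission
  imports Defs
begin

text \<open>
  The map \<open>M = h \<circ> rev\<close> satisfies \<open>M (\<lambda>(u) \<oplus> v) = M u \<oplus> \<lambda>(M v)\<close> (it is Donaghey's map).
  Write \<open>f x = \<lambda>(\<lambda>(e) \<oplus> \<lambda>(e)) \<oplus> x\<close>. Eight applications of \<open>M\<close> move the middle leaf of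
  \<open>\<lambda>(e) \<oplus> f\<^sup>i (\<lambda>(e) \<oplus> f\<^sup>j (\<lambda>(e)))\<close> one place to the right, turning \<open>(i, j)\<close> into \<open>(i + 1, j - 1)\<close>.
  Starting from \<open>(0, n)\<close> this shows \<open>M\<^sup>8\<^sup>n \<noteq> id\<close> for all \<open>n \<ge> 1\<close>, so \<open>M\<close> has infinite order.
  A group generated by two involutions whose product has infinite order is their free product,
  and if the orders of \<open>M\<close> on the levels were bounded by \<open>B\<close>, then \<open>M\<close> to the power \<open>B!\<close>
  would be the identity.
\<close>

section \<open>Involutions whose product has infinite order\<close>

context group
begin

text \<open>If one of the two were trivial, \<open>a \<otimes> b\<close> would be the other one, so
  its square would be trivial. Infinite order, encoded as \<open>ord = 0\<close>, forbids
  this.\<close>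

lemma involution_neq_one:
  assumes "a \<in> carrier G" "b \<in> carrier G" "a \<otimes> a = \<one>" "b \<otimes> b = \<one>" "ord (a \<otimes> b) = 0"
  shows "a \<noteq> \<one>" "b \<noteq> \<one>"
proof -
  have "(a \<otimes> b) [^] (2::nat) \<noteq> \<one>"
    using assms by (simp add: pow_eq_id)
  then have "(a \<otimes> b) \<otimes> (a \<otimes> b) \<noteq> \<one>"
    using assms by (simp add: numeral_2_eq_2)
  then show "a \<noteq> \<one>" "b \<noteq> \<one>"
    using assms by auto
qed

text \<open>An equality would make \<open>c [^] (2 * k)\<close> trivial; infinite order then forces
  \<open>k = 0\<close>, hence \<open>a = \<one>\<close>.\<close>

lemma pow_neq_involution:
  assumes "c \<in> carrier G" "a \<in> carrier G" "ord c = 0" "a \<otimes> a = \<one>" "a \<noteq> \<one>"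
  shows "c [^] (k::nat) \<noteq> a"
proof
  assume "c [^] k = a"
  with assms have "c [^] (k + k) = \<one>"
    using nat_pow_mult[of c k k] by simp
  with assms have "k = 0"
    using pow_eq_id[of c "k + k"] by simp
  with \<open>c [^] k = a\<close> assms show False by simp
qed

lemma carrier_generated_involution:
  assumes "a \<in> carrier G" "a \<otimes> a = \<one>" "a \<noteq> \<one>"
  shows "carrier (subgroup_generated G {a}) = {\<one>, a}"
proof -
  have inv: "inv a = a"
    using assms by (simp add: inv_equality)
  have "subgroup {\<one>, a} G"
    by (rule subgroupI) (use assms inv in auto)
  then have "generate G {a} \<subseteq> {\<one>, a}"
    by (intro generate_subgroup_incl) auto
  moreover have "{\<one>, a} \<subseteq> generate G {a}"
    using generate.one[of G "{a}"] generate.incl[of a "{a}" G] by simp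
  ultimately show ?thesis
    using assms by (auto simp: carrier_subgroup_generated)
qed

end

section \<open>Alternating words in two involutions\<close>

context
  fixes G :: "('a, 'c) monoid_scheme" and H :: "('b, 'd) monoid_scheme"
    and K :: "('k, 'm) monoid_scheme" and f :: "'a \<Rightarrow> 'k" and g :: "'b \<Rightarrow> 'k" and a b :: 'k
  assumes G: "group G" and H: "group H" and K: "group K"
    and f: "f \<in> hom G K" "inj_on f (carrier G)" "f ` carrier G = {\<one>\<^bsub>K\<^esub>, a}"
    and g: "g \<in> hom H K" "inj_on g (carrier H)" "g ` carrier H = {\<one>\<^bsub>K\<^esub>, b}"
    and a: "a \<otimes>\<^bsub>K\<^esub> a = \<one>\<^bsub>K\<^esub>" and b: "b \<otimes>\<^bsub>K\<^esub> b = \<one>\<^bsub>K\<^esub>"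
    and ord: "group.ord K (a \<otimes>\<^bsub>K\<^esub> b) = 0"
begin

interpretation K: group K by (fact K)
interpretation f: group_hom G K f
  using G f(1) by (intro group_hom.intro group_hom_axioms.intro K)
interpretation g: group_hom H K g
  using H g(1) by (intro group_hom.intro group_hom_axioms.intro K)

lemma involutions_closed: "a \<in> carrier K" "b \<in> carrier K"
proof -
  have "a \<in> f ` carrier G" "b \<in> g ` carrier H"
    using f(3) g(3) by simp_all
  then show "a \<in> carrier K" "b \<in> carrier K"
    by auto
qed

text \<open>Letters of a reduced word are nontrivial, and an injective homomorphism onto
  \<open>{\<one>, a}\<close> has only \<open>a\<close> left as their value.\<close>

lemma free_product_lift_Cons:
  assumes "x # w \<in> reduced_words G H"
  shows "free_product_lift K f g (x # w) =
    (if isl x then a else b) \<otimes>\<^bsub>K\<^esub> free_product_lift K f g w"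
proof -
  have "case_sum f g x = (if isl x then a else b)"
  proof (cases x)
    case (Inl y)
    with assms have "y \<in> carrier G" "y \<noteq> \<one>\<^bsub>G\<^esub>"
      by (auto simp: reduced_words_def)
    then have "f y \<in> {\<one>\<^bsub>K\<^esub>, a}" and "f y \<noteq> \<one>\<^bsub>K\<^esub>"
      using f(3) inj_onD[OF f(2), of y "\<one>\<^bsub>G\<^esub>"] by auto
    with Inl show ?thesis by simp
  next
    case (Inr y)
    with assms have "y \<in> carrier H" "y \<noteq> \<one>\<^bsub>H\<^esub>"
      by (auto simp: reduced_words_def)
    then have "g y \<in> {\<one>\<^bsub>K\<^esub>, b}" and "g y \<noteq> \<one>\<^bsub>K\<^esub>"
      using g(3) inj_onD[OF g(2), of y "\<one>\<^bsub>H\<^esub>"] by auto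
    with Inr show ?thesis by simp
  qed
  then show ?thesis
    by (simp add: free_product_lift_def)
qed

text \<open>Values of reduced words alternate between \<open>a\<close> and \<open>b\<close>. Writing
  them through powers of \<open>c\<close>, with a possible \<open>b\<close> in front and
  \<open>a\<close> behind, avoids inverses of \<open>c\<close>; \<open>Suc k\<close> keeps out the
  empty product.\<close>

lemma free_product_lift_normal_form:
  assumes "w \<in> reduced_words G H" "w \<noteq> []"
  defines "c \<equiv> a \<otimes>\<^bsub>K\<^esub> b"
  shows "\<exists>k::nat. free_product_lift K f g w \<in>
    (if isl (hd w) then {c [^]\<^bsub>K\<^esub> Suc k, c [^]\<^bsub>K\<^esub> k \<otimes>\<^bsub>K\<^esub> a}
     else {b \<otimes>\<^bsub>K\<^esub> c [^]\<^bsub>K\<^esub> k, b \<otimes>\<^bsub>K\<^esub> (c [^]\<^bsub>K\<^esub> k \<otimes>\<^bsub>K\<^esub> a)})"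
  using assms(1,2)
proof (induction w)
  case (Cons x w)
  have c: "c \<in> carrier K"
    using involutions_closed by (simp add: c_def)
  have c_Suc: "a \<otimes>\<^bsub>K\<^esub> (b \<otimes>\<^bsub>K\<^esub> (c [^]\<^bsub>K\<^esub> k \<otimes>\<^bsub>K\<^esub> z)) = c [^]\<^bsub>K\<^esub> Suc k \<otimes>\<^bsub>K\<^esub> z"
    if "z \<in> carrier K" for k :: nat and z
    using that c involutions_closed K.nat_pow_Suc2[OF c, of k]
    by (simp add: c_def K.m_assoc del: K.nat_pow_Suc)
  have c_Suc': "a \<otimes>\<^bsub>K\<^esub> (b \<otimes>\<^bsub>K\<^esub> c [^]\<^bsub>K\<^esub> k) = c [^]\<^bsub>K\<^esub> Suc k" for k :: nat
    using c_Suc[of "\<one>\<^bsub>K\<^esub>" k] c by (simp del: K.nat_pow_Suc)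
  note lift = free_product_lift_Cons[OF Cons.prems(1)]
  show ?case
  proof (cases w)
    case Nil
    \<comment> \<open>One letter has exponent 0: the value is \<open>a\<close> after the empty
      power, or \<open>b\<close> before it.\<close>
    then show ?thesis
      using lift involutions_closed by (intro exI[of _ 0]) (simp add: free_product_lift_def)
  next
    case (Cons y w')
    with Cons.prems have w: "w \<in> reduced_words G H" "w \<noteq> []" "isl x \<noteq> isl (hd w)"
      by (auto simp: reduced_words_def successively_Cons)
    obtain k :: nat where k: "free_product_lift K f g w \<in>
        (if isl (hd w) then {c [^]\<^bsub>K\<^esub> Suc k, c [^]\<^bsub>K\<^esub> k \<otimes>\<^bsub>K\<^esub> a}
         else {b \<otimes>\<^bsub>K\<^esub> c [^]\<^bsub>K\<^esub> k, b \<otimes>\<^bsub>K\<^esub> (c [^]\<^bsub>K\<^esub> k \<otimes>\<^bsub>K\<^esub> a)})"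
      using Cons.IH w by blast
    show ?thesis
    proof (cases "isl x")
      case True
      with k w lift have "free_product_lift K f g (x # w) \<in>
          {c [^]\<^bsub>K\<^esub> Suc k, c [^]\<^bsub>K\<^esub> Suc k \<otimes>\<^bsub>K\<^esub> a}"
        using c_Suc[OF involutions_closed(1), of k] c_Suc'[of k] by (auto simp del: K.nat_pow_Suc)
      then show ?thesis
      proof (elim insertE emptyE)
        assume "free_product_lift K f g (x # w) = c [^]\<^bsub>K\<^esub> Suc k"
        with True show ?thesis
          by (intro exI[of _ k]) simp
      next
        assume "free_product_lift K f g (x # w) = c [^]\<^bsub>K\<^esub> Suc k \<otimes>\<^bsub>K\<^esub> a"
        with True show ?thesis
          by (intro exI[of _ "Suc k"]) simp
      qed
    next
      case False
      with k w lift have "free_product_lift K f g (x # w) \<in>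
          {b \<otimes>\<^bsub>K\<^esub> c [^]\<^bsub>K\<^esub> Suc k, b \<otimes>\<^bsub>K\<^esub> (c [^]\<^bsub>K\<^esub> k \<otimes>\<^bsub>K\<^esub> a)}"
        by (auto simp del: K.nat_pow_Suc)
      then show ?thesis
      proof (elim insertE emptyE)
        assume "free_product_lift K f g (x # w) = b \<otimes>\<^bsub>K\<^esub> c [^]\<^bsub>K\<^esub> Suc k"
        with False show ?thesis
          by (intro exI[of _ "Suc k"]) simp
      next
        assume "free_product_lift K f g (x # w) = b \<otimes>\<^bsub>K\<^esub> (c [^]\<^bsub>K\<^esub> k \<otimes>\<^bsub>K\<^esub> a)"
        with False show ?thesis
          by (intro exI[of _ k]) simp
      qed
    qed
  qed
qed simp

text \<open>Each normal form, if trivial, would make \<open>a\<close> or \<open>b\<close> a power of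
  \<open>c\<close>, or give \<open>c\<close> finite order.\<close>

lemma free_product_lift_neq_one:
  assumes "w \<in> reduced_words G H" "w \<noteq> []"
  shows "free_product_lift K f g w \<noteq> \<one>\<^bsub>K\<^esub>"
proof -
  define c where "c = a \<otimes>\<^bsub>K\<^esub> b"
  have c: "c \<in> carrier K" "K.ord c = 0"
    using involutions_closed ord by (simp_all add: c_def)
  note ab = K.involution_neq_one[OF involutions_closed a b ord]
  have pow: "c [^]\<^bsub>K\<^esub> Suc k \<noteq> \<one>\<^bsub>K\<^esub>" for k
    using K.pow_eq_id[OF c(1), of "Suc k"] c(2) by simp
  have powa: "c [^]\<^bsub>K\<^esub> k \<noteq> a" and powb: "c [^]\<^bsub>K\<^esub> k \<noteq> b" for k :: nat
    using K.pow_neq_involution c involutions_closed a b ab by blast+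
  have inv: "inv\<^bsub>K\<^esub> a = a" "inv\<^bsub>K\<^esub> b = b"
    using involutions_closed a b by (simp_all add: K.inv_equality)
  have "c [^]\<^bsub>K\<^esub> k \<otimes>\<^bsub>K\<^esub> a \<noteq> \<one>\<^bsub>K\<^esub>" for k :: nat
    using powa[of k] c involutions_closed inv K.inv_equality[of "c [^]\<^bsub>K\<^esub> k" a] by auto
  moreover have "b \<otimes>\<^bsub>K\<^esub> c [^]\<^bsub>K\<^esub> k \<noteq> \<one>\<^bsub>K\<^esub>" for k :: nat
    using powb[of k] c involutions_closed inv K.inv_equality[of b "c [^]\<^bsub>K\<^esub> k"]
    by (metis K.inv_inv K.nat_pow_closed)
  moreover have "b \<otimes>\<^bsub>K\<^esub> (c [^]\<^bsub>K\<^esub> k \<otimes>\<^bsub>K\<^esub> a) \<noteq> \<one>\<^bsub>K\<^esub>" for k :: nat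
  proof
    assume *: "b \<otimes>\<^bsub>K\<^esub> (c [^]\<^bsub>K\<^esub> k \<otimes>\<^bsub>K\<^esub> a) = \<one>\<^bsub>K\<^esub>"
    \<comment> \<open>Conjugation by \<open>a\<close> turns the product in \<open>*\<close> into a
      positive power of \<open>c\<close>.\<close>
    have "c [^]\<^bsub>K\<^esub> Suc k = a \<otimes>\<^bsub>K\<^esub> (b \<otimes>\<^bsub>K\<^esub> (c [^]\<^bsub>K\<^esub> k \<otimes>\<^bsub>K\<^esub> a)) \<otimes>\<^bsub>K\<^esub> a"
      using K.nat_pow_Suc2[OF c(1), of k] c involutions_closed a
      by (simp add: c_def K.m_assoc del: K.nat_pow_Suc)
    with * involutions_closed a pow[of k] show False
      by (simp del: K.nat_pow_Suc)
  qed
  ultimately show ?thesis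
    using free_product_lift_normal_form[OF assms] pow unfolding c_def
    by (auto split: if_splits)
qed

text \<open>Trivial kernel gives injectivity; the one-letter words give both generators. The factors
  stay abstract so that subgroups of \<open>K\<close> and copies of the integers mod 2 both
  fit.\<close>

lemma free_product_lift_involutions_iso:
  "free_product_lift K f g \<in> iso (free_product G H) (subgroup_generated K {a, b})"
proof -
  let ?F = "free_product_lift K f g"
  interpret P: group "free_product G H"
    by (rule group_free_product[OF G H])
  have hom: "?F \<in> hom (free_product G H) K"
    by (rule free_product_lift_hom[OF G H K f(1) g(1)])
  then interpret F: group_hom "free_product G H" K ?F
    by unfold_locales
  have gen: "carrier (subgroup_generated K {a, b}) = generate K {a, b}"
    using involutions_closed by (simp add: carrier_subgroup_generated)
  have "?F w \<in> generate K {a, b}" if "w \<in> reduced_words G H" for w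
    using that
  proof (induction w)
    case Nil
    then show ?case by (simp add: free_product_lift_def generate.one)
  next
    case (Cons x w)
    then have "?F w \<in> generate K {a, b}"
      using reduced_ConsD(1)[OF G H] by blast
    moreover have "(if isl x then a else b) \<in> generate K {a, b}"
      by (auto intro: generate.incl)
    ultimately show ?case
      unfolding free_product_lift_Cons[OF Cons.prems] by (rule generate.eng[rotated])
  qed
  then have sub: "?F ` carrier (free_product G H) \<subseteq> generate K {a, b}"
    by (auto simp: free_product_def)
  have letters: "{a, b} \<subseteq> ?F ` carrier (free_product G H)"
  proof -
    have "a \<in> f ` carrier G" "b \<in> g ` carrier H"
      using f(3) g(3) by simp_all
    then obtain x y where x: "x \<in> carrier G" "f x = a" and y: "y \<in> carrier H" "g y = b"
      by blast
    note red = letter_mult_reduced[OF G H _ Nil_reduced[OF G H]]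
    \<comment> \<open>Multiplying into \<open>[]\<close> gives a reduced word for any
      \<open>x\<close>, so \<open>x\<close> need not be shown nontrivial.\<close>
    have mem: "letter_mult G H (Inl x) [] \<in> carrier (free_product G H)"
      "letter_mult G H (Inr y) [] \<in> carrier (free_product G H)"
      using red[OF InlI[OF x(1)]] red[OF InrI[OF y(1)]]
      by (simp_all add: free_product_def del: letter_mult.simps)
    have val: "?F (letter_mult G H (Inl x) []) = a" "?F (letter_mult G H (Inr y) []) = b"
      by (simp_all only: x y free_product_lift_factors[OF G H K f(1) g(1)])
    show ?thesis
      using imageI[OF mem(1), of ?F] imageI[OF mem(2), of ?F] unfolding val by simp
  qed
  have "generate K {a, b} \<subseteq> ?F ` carrier (free_product G H)"
    using K.generate_subgroup_incl[OF letters F.img_is_subgroup] .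
  with sub have img: "?F ` carrier (free_product G H) = generate K {a, b}"
    by blast
  have "inj_on ?F (carrier (free_product G H))"
    using free_product_lift_neq_one
    by (subst F.inj_on_one_iff) (auto simp: free_product_def)
  moreover have "?F \<in> hom (free_product G H) (subgroup_generated K {a, b})"
    using hom img gen by (simp add: hom_into_subgroup_eq_gen K)
  ultimately show ?thesis
    using img gen by (simp add: iso_def bij_betw_def)
qed

end


section \<open>The map \<open>M\<close> and its drift\<close>

definition donaghey :: "catalan \<Rightarrow> catalan" where
  "donaghey = cat_h \<circ> cat_rev"

lemma donaghey_Emp [simp]: "donaghey Emp = Emp"
  by (simp add: donaghey_def)

text \<open>\<open>cat_h\<close> turns sums into \<open>\<ominus>c\<close> in reverse order, and
  \<open>\<ominus>c\<close> grafts at the end of the rightmost path, which in \<open>gam t\<close>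
  is the leaf just added.\<close>

lemma donaghey_Join [simp]: "donaghey (Join u v) = donaghey u \<oplus>c lam (donaghey v)"
proof -
  have "donaghey (Join u v) = gam (donaghey u) \<ominus>c donaghey v"
    by (simp add: donaghey_def cat_h_oplus lam_def)
  also have "\<dots> = donaghey u \<oplus>c lam (donaghey v)"
    by (cases "donaghey u = Emp") (simp_all add: gam_def ominus_oplus lam_def)
  finally show ?thesis .
qed

section \<open>Trees that drift under the map\<close>

abbreviation edge :: catalan where
  "edge \<equiv> Join Emp Emp"

abbreviation (input) prepend_cherry :: "catalan \<Rightarrow> catalan" where
  "prepend_cherry \<equiv> Join (Join Emp edge)"

text \<open>
  The trees along the drift are built from the iterates of \<open>prepend_cherry\<close> and of three further
  maps, each of which is what \<open>M\<close> makes of the previous one; \<open>M\<close> turns the last one back into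
  \<open>prepend_cherry\<close>.
\<close>

abbreviation (input) drift1 :: "catalan \<Rightarrow> catalan" where
  "drift1 x \<equiv> Join edge (lam x)"

abbreviation (input) drift2 :: "catalan \<Rightarrow> catalan" where
  "drift2 x \<equiv> Join Emp (Join x edge)"

abbreviation (input) drift3 :: "catalan \<Rightarrow> catalan" where
  "drift3 x \<equiv> Join x (lam edge)"

lemma prepend_cherry_oplus: "(prepend_cherry ^^ i) x \<oplus>c y = (prepend_cherry ^^ i) (x \<oplus>c y)"
  by (induction i) simp_all

lemma donaghey_prepend_cherry:
  "donaghey ((prepend_cherry ^^ i) x) = (drift1 ^^ i) (donaghey x)"
  by (induction i) (simp_all add: lam_def)

text \<open>The image of \<open>drift1 x\<close> depends on
  \<open>donaghey x \<oplus>c edge\<close>; carrying the trailing edge on both sides closes the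
  induction.\<close>

lemma donaghey_drift1:
  "donaghey ((drift1 ^^ i) x) \<oplus>c edge = (drift2 ^^ i) (donaghey x \<oplus>c edge)"
  by (induction i) (simp_all add: lam_def)

lemma donaghey_drift2:
  "donaghey x = lam y \<Longrightarrow> donaghey ((drift2 ^^ i) x) = lam ((drift3 ^^ i) y)"
  by (induction i) (simp_all add: lam_def)

text \<open>Each layer of \<open>drift3\<close> appends a cherry on the right; \<open>y\<close>
  accumulates these, so it must vary in the induction. This also reverses the nesting of
  blocks.\<close>

lemma donaghey_drift3:
  "donaghey ((drift3 ^^ i) x) \<oplus>c y = donaghey x \<oplus>c (prepend_cherry ^^ i) y"
proof (induction i arbitrary: y)
  case (Suc i)
  have "donaghey ((drift3 ^^ Suc i) x) \<oplus>c y = donaghey ((drift3 ^^ i) x) \<oplus>c prepend_cherry y"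
    by (simp add: lam_def oplus_assoc)
  then show ?case
    by (simp only: Suc.IH funpow_Suc_right o_apply)
qed simp

definition drift_tree :: "nat \<Rightarrow> nat \<Rightarrow> catalan" where
  "drift_tree i j = Join Emp ((prepend_cherry ^^ i) (Join Emp ((prepend_cherry ^^ j) edge)))"

text \<open>After four steps the blocks have changed places, and the middle leaf and one cherry have
  merged into a child with three leaves. Four more steps restore the order and leave that cherry in
  the first block.\<close>

lemma donaghey_drift_tree: "(donaghey ^^ 8) (drift_tree i (Suc j)) = drift_tree (Suc i) j"
proof -
  \<comment> \<open>The cherry \<open>c\<close> equals \<open>donaghey edge \<oplus>c edge\<close>,
    the base produced by \<open>donaghey_drift1\<close>; its image is a \<open>lam\<close>, as
    \<open>donaghey_drift2\<close> requires.\<close>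
  define c where "c = Join Emp edge"
  have M_edge: "donaghey edge = edge" and M_c: "donaghey c = lam edge"
    and M_lam: "donaghey (lam x) = donaghey x \<oplus>c edge" for x
    by (simp_all add: lam_def c_def)
  have 1: "donaghey (drift_tree i (Suc j)) = lam ((drift1 ^^ i) (lam ((drift1 ^^ Suc j) edge)))"
    by (simp add: drift_tree_def donaghey_prepend_cherry lam_def del: funpow.simps)
  have 2: "donaghey \<dots> = (drift2 ^^ i) (Join Emp (Join ((drift2 ^^ j) c) c))"
    unfolding M_lam donaghey_drift1 by (simp add: M_edge c_def lam_def)
  have 3: "donaghey \<dots> = lam ((drift3 ^^ i) (Join ((drift3 ^^ j) edge) (lam (lam edge))))"
    by (rule donaghey_drift2) (simp add: donaghey_drift2[OF M_c] M_c, simp add: lam_def)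
  have 4: "donaghey \<dots> = Join Emp ((prepend_cherry ^^ j)
      (Join (Join Emp c) ((prepend_cherry ^^ i) edge)))"
    unfolding M_lam donaghey_drift3
    by (simp add: donaghey_drift3[unfolded lam_def] prepend_cherry_oplus M_edge c_def lam_def oplus_assoc)
  have 5: "donaghey \<dots> = lam ((drift1 ^^ j) (Join (lam edge) (lam ((drift1 ^^ i) edge))))"
    by (simp add: donaghey_prepend_cherry c_def lam_def)
  have 6: "donaghey \<dots> = (drift2 ^^ j) (Join Emp ((drift2 ^^ Suc i) c))"
    unfolding M_lam donaghey_drift1
    using donaghey_drift1[of i edge] by (simp add: M_lam c_def lam_def oplus_assoc)
  have 7: "donaghey \<dots> = lam ((drift3 ^^ j) (lam ((drift3 ^^ Suc i) edge)))"
    by (rule donaghey_drift2) (simp add: donaghey_drift2[OF M_c] del: funpow.simps)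
  have 8: "donaghey \<dots> = drift_tree (Suc i) j"
    unfolding M_lam donaghey_drift3
    by (simp add: M_edge drift_tree_def prepend_cherry_oplus lam_def del: funpow.simps)
  show ?thesis
    using 1 2 3 4 5 6 7 8 by (simp add: eval_nat_numeral)
qed

lemma donaghey_pow_neq_id:
  assumes "n > 0"
  shows "donaghey ^^ n \<noteq> id"
proof
  assume *: "donaghey ^^ n = id"
  have drift: "(donaghey ^^ (8 * k)) (drift_tree i (k + j)) = drift_tree (i + k) j" for k i j
  proof (induction k arbitrary: i)
    case (Suc k)
    have "donaghey ^^ (8 * Suc k) = (donaghey ^^ (8 * k)) \<circ> (donaghey ^^ 8)"
      by (simp flip: funpow_add add: add.commute)
    with Suc[of "Suc i"] show ?case
      by (simp add: donaghey_drift_tree)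
  qed simp
  have "donaghey ^^ (8 * n) = (donaghey ^^ n) ^^ 8"
    by (simp add: funpow_mult mult.commute)
  with * drift[of n 0 0] have "drift_tree 0 n = drift_tree n 0"
    by simp
  with assms show False
    \<comment> \<open>The second child of the root is a leaf in one tree and a cherry in the
      other.\<close>
    by (cases n) (simp_all add: drift_tree_def)
qed


section \<open>Orders in permutation groups\<close>

lemma finite_BijGroup: "finite S \<Longrightarrow> finite (carrier (BijGroup S))"
proof -
  assume "finite S"
  moreover have "Bij S \<subseteq> S \<rightarrow>\<^sub>E S"
    by (auto simp: Bij_def bij_betw_def PiE_def)
  ultimately show ?thesis
    by (simp add: BijGroup_def finite_PiE finite_subset)
qed

lemma restrict_UNIV: "restrict f UNIV = f"
  by (simp add: restrict_def)

text \<open>The hypothesis makes \<open>f\<close> map \<open>S\<close> into itself, so iterating the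
  restriction agrees with restricting the iterate.\<close>

lemma BijGroup_nat_pow:
  assumes "restrict f S \<in> carrier (BijGroup S)"
  shows "restrict f S [^]\<^bsub>BijGroup S\<^esub> (k::nat) = restrict (f ^^ k) S"
proof (induction k)
  case 0
  then show ?case
    by (auto simp: BijGroup_def)
next
  case (Suc k)
  interpret group "BijGroup S" by (rule group_BijGroup)
  have "restrict (f ^^ k) S \<in> carrier (BijGroup S)"
    using assms Suc by (metis nat_pow_closed)
  with assms have "restrict f S [^]\<^bsub>BijGroup S\<^esub> Suc k = compose S (restrict (f ^^ k) S) (restrict f S)"
    unfolding nat_pow_Suc Suc by (simp add: BijGroup_def)
  moreover have "f x \<in> S" if "x \<in> S" for x
    using assms that by (auto simp: BijGroup_def Bij_def bij_betw_def)
  ultimately show ?case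
    by (auto simp: compose_def funpow_swap1 fun_eq_iff simp del: restrict_apply)
       (auto simp: funpow_swap1)
qed

section \<open>Infinite order, globally and in the limit over levels\<close>

lemma ord_donaghey: "group.ord (BijGroup UNIV) donaghey = 0"
proof -
  interpret group "BijGroup (UNIV :: catalan set)" by (rule group_BijGroup)
  have mem: "donaghey \<in> carrier (BijGroup UNIV)"
    using bij_cat_h bij_cat_rev by (simp add: BijGroup_def Bij_def donaghey_def bij_comp)
  then have "donaghey [^]\<^bsub>BijGroup UNIV\<^esub> n = donaghey ^^ n" for n :: nat
    using BijGroup_nat_pow[of donaghey UNIV n] by (simp only: restrict_UNIV)
  moreover have "\<one>\<^bsub>BijGroup UNIV\<^esub> = (id :: catalan \<Rightarrow> catalan)"
    by (auto simp: BijGroup_def)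
  ultimately have "donaghey ^^ ord donaghey = id"
    using pow_ord_eq_1[OF mem] by simp
  then show ?thesis
    using donaghey_pow_neq_id by blast
qed

lemma ord_donaghey_level_unbounded:
  "\<not> bdd_above (range (\<lambda>n. group.ord (BijGroup (catalan_level n)) (restrict donaghey (catalan_level n))))"
proof
  assume "bdd_above (range (\<lambda>n. group.ord (BijGroup (catalan_level n))
    (restrict donaghey (catalan_level n))))"
  then obtain B where B: "group.ord (BijGroup (catalan_level n))
      (restrict donaghey (catalan_level n)) \<le> B" for n
    by (auto simp: bdd_above_def)
  have "(donaghey ^^ fact B) t = t" for t
  proof -
    define S where "S = catalan_level (catalan_size t)"
    interpret group "BijGroup S" by (rule group_BijGroup)
    have mem: "restrict donaghey S \<in> carrier (BijGroup S)"
      using restrict_cat_h_cat_rev_in_BijGroup by (simp add: S_def donaghey_def)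
    have "finite (carrier (BijGroup S))"
      by (simp add: S_def finite_BijGroup finite_catalan_level)
    \<comment> \<open>Finiteness of the level excludes the value 0, which would not divide the
      factorial.\<close>
    then have "ord (restrict donaghey S) \<ge> 1"
      using mem by (rule ord_ge_1)
    then have "ord (restrict donaghey S) dvd fact B"
      using B by (intro dvd_fact) (simp_all add: S_def)
    then have "restrict (donaghey ^^ fact B) S = \<one>\<^bsub>BijGroup S\<^esub>"
      using pow_eq_id[OF mem, of "fact B"] unfolding BijGroup_nat_pow[OF mem] by simp
    then have "restrict (donaghey ^^ fact B) S t = restrict (\<lambda>x. x) S t"
      by (simp add: BijGroup_def)
    then show ?thesis
      by (simp add: S_def catalan_level_def)
  qed
  then have "donaghey ^^ fact B = id"
    by (simp add: fun_eq_iff)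
  then show False
    using donaghey_pow_neq_id[of "fact B"] by simp
qed

theorem corollary5p11:
  shows "order (generated_perms {cat_h}) = 2 \<and>
    order (generated_perms {cat_rev}) = 2 \<and>
    free_product_lift (BijGroup UNIV) id id
      \<in> iso (free_product (generated_perms {cat_h}) (generated_perms {cat_rev}))
          (generated_perms {cat_h, cat_rev}) \<and>
    generated_perms {cat_h, cat_rev}
      \<cong> free_product (integer_mod_group 2) (integer_mod_group 2) \<and>
    group.ord (BijGroup UNIV) (cat_h \<circ> cat_rev) = 0 \<and>
    \<not> bdd_above (range (\<lambda>n. group.ord (BijGroup (catalan_level n))
        (restrict (cat_h \<circ> cat_rev) (catalan_level n))))"
proof -
  let ?K = "BijGroup (UNIV :: catalan set)"
  interpret K: group ?K by (rule group_BijGroup)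
  have mult: "f \<otimes>\<^bsub>?K\<^esub> g = f \<circ> g" if "f \<in> carrier ?K" "g \<in> carrier ?K" for f g
    using that by (auto simp: BijGroup_def compose_def)
  have one: "\<one>\<^bsub>?K\<^esub> = id"
    by (auto simp: BijGroup_def)
  note hr = cat_h_in_BijGroup cat_rev_in_BijGroup
  have inv: "cat_h \<otimes>\<^bsub>?K\<^esub> cat_h = \<one>\<^bsub>?K\<^esub>" "cat_rev \<otimes>\<^bsub>?K\<^esub> cat_rev = \<one>\<^bsub>?K\<^esub>"
    using hr by (auto simp: mult one)
  have ord: "K.ord (cat_h \<otimes>\<^bsub>?K\<^esub> cat_rev) = 0"
    using hr ord_donaghey by (simp add: mult donaghey_def)
  note ne = K.involution_neq_one[OF hr inv ord]
  have carrier: "carrier (generated_perms {cat_h}) = {\<one>\<^bsub>?K\<^esub>, cat_h}"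
    "carrier (generated_perms {cat_rev}) = {\<one>\<^bsub>?K\<^esub>, cat_rev}"
    using K.carrier_generated_involution hr inv ne by blast+
  then have orders: "order (generated_perms {cat_h}) = 2" "order (generated_perms {cat_rev}) = 2"
    using ne by (auto simp: order_def)
  have id_hom: "id \<in> hom (subgroup_generated ?K S) ?K" for S
    by (auto simp: hom_def dest: subsetD[OF K.carrier_subgroup_generated_subset])
  have iso: "free_product_lift ?K id id
      \<in> iso (free_product (generated_perms {cat_h}) (generated_perms {cat_rev}))
          (generated_perms {cat_h, cat_rev})"
    by (rule free_product_lift_involutions_iso)
      (use id_hom carrier inv ord in simp_all)
  \<comment> \<open>For an involution \<open>a\<close>, the power map embeds the integers mod 2,
    sending 1 to \<open>a\<close>. This yields the second instance of the isomorphism, with factors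
    independent of the permutations.\<close>
  let ?pow = "\<lambda>a n. a [^]\<^bsub>?K\<^esub> (n :: int)"
  have Z2: "carrier (integer_mod_group 2) = {0, 1}"
    by (auto simp: carrier_integer_mod_group)
  have pow: "?pow a \<in> hom (integer_mod_group 2) ?K \<and> inj_on (?pow a) (carrier (integer_mod_group 2)) \<and>
      ?pow a ` carrier (integer_mod_group 2) = {\<one>\<^bsub>?K\<^esub>, a}"
    if "a \<in> carrier ?K" "a \<otimes>\<^bsub>?K\<^esub> a = \<one>\<^bsub>?K\<^esub>" "a \<noteq> \<one>\<^bsub>?K\<^esub>" for a
    using that by (auto simp: hom_def Z2 mult_integer_mod_group)
  have "free_product_lift ?K (?pow cat_h) (?pow cat_rev)
      \<in> iso (free_product (integer_mod_group 2) (integer_mod_group 2)) (generated_perms {cat_h, cat_rev})"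
    by (rule free_product_lift_involutions_iso)
      (use pow hr inv ne ord in simp_all)
  then have "free_product (integer_mod_group 2) (integer_mod_group 2)
      \<cong> generated_perms {cat_h, cat_rev}"
    by (rule is_isoI)
  then have "generated_perms {cat_h, cat_rev}
      \<cong> free_product (integer_mod_group 2) (integer_mod_group 2)"
    by (rule group.iso_sym[OF group_free_product[OF group_integer_mod_group group_integer_mod_group]])
  with orders iso show ?thesis
    using ord_donaghey ord_donaghey_level_unbounded by (simp add: donaghey_def)
qed

end
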